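(* There exists a compact set $K\subset \mathbb{R}^n$ of positive Lebesgue measure that is $W^{1,\infty}$-removable.
   Context: For an open set $U\subset\mathbb{R}^n$, $f\in W^{1,\infty}(U)$ means that $f\in L^\infty(U)$ and $f$ has weak (first-order) derivatives in $U$ that lie in $L^\infty(U)$. A compact set $K\subset\mathbb{R}^n$ is $W^{1,\infty}$-removable if every real-valued function that is continuous in $\mathbb{R}^n$ and lies in $W^{1,\infty}(\mathbb{R}^n\setminus K)$ also lies in $W^{1,\infty}(\mathbb{R}^n)$.
   Formalization: The dimension is assumed to be n ≥ 2; for n = 1 the claim is false, since a compact set of positive measure contains a perfect null set whose Cantor function is continuous and locally constant off K but not Lipschitz. *)

theory Defs
  imports "HOL-Analysis.Analysis"
begin

definition partial_derivative :: "'n \<Rightarrow> (real ^ 'n \<Rightarrow> real) \<Rightarrow> real ^ 'n \<Rightarrow> real" where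
  "partial_derivative i f x = frechet_derivative f (at x) (axis i 1)"

primrec Ck_function :: "nat \<Rightarrow> (real ^ 'n \<Rightarrow> real) \<Rightarrow> bool" where
  "Ck_function 0 f \<longleftrightarrow> continuous_on UNIV f"
| "Ck_function (Suc k) f \<longleftrightarrow>
     (\<forall>x. f differentiable (at x)) \<and> (\<forall>i. Ck_function k (partial_derivative i f))"

text \<open>
  Elements of \<open>C\<^sub>c\<^sup>\<infinity>(U)\<close> are represented by their extension by zero to the whole space,
  which is again smooth because the support is a compact subset of the open set \<open>U\<close>.
\<close>

definition test_function :: "(real ^ 'n) set \<Rightarrow> (real ^ 'n \<Rightarrow> real) \<Rightarrow> bool" where
  "test_function U \<phi> \<longleftrightarrow>
     (\<forall>k. Ck_function k \<phi>) \<and> compact (closure {x. \<phi> x \<noteq> 0}) \<and> closure {x. \<phi> x \<noteq> 0} \<subseteq> U"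

definition locally_integrable :: "(real ^ 'n) set \<Rightarrow> (real ^ 'n \<Rightarrow> real) \<Rightarrow> bool" where
  "locally_integrable U f \<longleftrightarrow> (\<forall>C. compact C \<and> C \<subseteq> U \<longrightarrow> set_integrable lebesgue C f)"

definition weak_partial_derivative ::
    "(real ^ 'n) set \<Rightarrow> 'n \<Rightarrow> (real ^ 'n \<Rightarrow> real) \<Rightarrow> (real ^ 'n \<Rightarrow> real) \<Rightarrow> bool" where
  "weak_partial_derivative U i f g \<longleftrightarrow>
     locally_integrable U f \<and> locally_integrable U g \<and>
     (\<forall>\<phi>. test_function U \<phi> \<longrightarrow>
        (LINT x:U|lebesgue. f x * partial_derivative i \<phi> x) = - (LINT x:U|lebesgue. g x * \<phi> x))"

definition L_infinity :: "(real ^ 'n) set \<Rightarrow> (real ^ 'n \<Rightarrow> real) set" where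
  "L_infinity U =
     {f \<in> borel_measurable (lebesgue_on U). \<exists>B. AE x in lebesgue_on U. \<bar>f x\<bar> \<le> B}"

text \<open>
  Functions are total; membership below depends only on the values on \<open>U\<close>, so it applies to
  the restriction to \<open>U\<close> of a function defined on the whole space.
\<close>

definition W1_infinity :: "(real ^ 'n) set \<Rightarrow> (real ^ 'n \<Rightarrow> real) set" where
  "W1_infinity U =
     {f \<in> L_infinity U. \<forall>i. \<exists>g \<in> L_infinity U. weak_partial_derivative U i f g}"

definition W1_infinity_removable :: "(real ^ 'n) set \<Rightarrow> bool" where
  "W1_infinity_removable K \<longleftrightarrow>
     compact K \<and>
     (\<forall>f. continuous_on UNIV f \<and> f \<in> W1_infinity (UNIV - K) \<longrightarrow> f \<in> W1_infinity UNIV)"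

end

theory Submission
  imports Defs
begin

text \<open>
  Let \<open>T\<close> be an open set of measure less than 1 that contains all points with at least one rational
  coordinate, and \<open>K = [0,1]\<^sup>n - T\<close>. Since \<open>n \<ge> 2\<close>, a line parallel to a coordinate axis through a point
  with all coordinates rational stays in \<open>T\<close> and misses \<open>K\<close>. Mollification shows that a continuous
  function in \<open>W\<^sup>1\<^sup>,\<^sup>\<infinity>\<close> off \<open>K\<close> is Lipschitz along these lines, and as they are dense, along all
  axis-parallel lines by continuity. A weak partial derivative on the whole space is then a weak
  limit of difference quotients. The limit is obtained without a compactness theorem or
  Rademacher's theorem, by minimising the \<open>L\<^sup>2\<close>-norm (for an equivalent finite measure) over
  averages of the tails of the sequence.
\<close>

section \<open>Smooth bump functions\<close>

lemma partial_derivativeI: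
  "(f has_derivative f') (at x) \<Longrightarrow> partial_derivative i f x = f' (axis i 1)"
  unfolding partial_derivative_def by (simp add: frechet_derivative_at [symmetric])

lemma Ck_function_Suc_imp: "Ck_function (Suc k) f \<Longrightarrow> Ck_function k f"
proof (induction k arbitrary: f)
  case 0
  then show ?case
    by (auto intro!: continuous_at_imp_continuous_on differentiable_imp_continuous_within)
next
  case (Suc k)
  then show ?case by (metis Ck_function.simps(2))
qed

lemma Ck_function_const: "Ck_function k (\<lambda>x. c)"
proof (induction k arbitrary: c)
  case (Suc k)
  have "partial_derivative i (\<lambda>x. c) = (\<lambda>x. 0)" for i :: 'a
    by (rule ext, subst partial_derivativeI[where f' = "\<lambda>x. 0"]) auto
  with Suc show ?case by simp
qed simp

lemma Ck_function_add:
  "Ck_function k f \<Longrightarrow> Ck_function k g \<Longrightarrow> Ck_function k (\<lambda>x. f x + g x)"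
proof (induction k arbitrary: f g)
  case 0
  then show ?case by (simp add: continuous_on_add)
next
  case (Suc k)
  have d: "(f has_derivative frechet_derivative f (at x)) (at x)"
    "(g has_derivative frechet_derivative g (at x)) (at x)" for x
    using Suc.prems by (auto simp: frechet_derivative_works)
  have "partial_derivative i (\<lambda>x. f x + g x) =
      (\<lambda>x. partial_derivative i f x + partial_derivative i g x)" for i
    by (rule ext, subst partial_derivativeI[OF has_derivative_add[OF d]])
      (simp add: partial_derivative_def)
  with Suc show ?case by (auto intro!: differentiable_add)
qed

lemma Ck_function_mult:
  "Ck_function k f \<Longrightarrow> Ck_function k g \<Longrightarrow> Ck_function k (\<lambda>x. f x * g x)"
proof (induction k arbitrary: f g)
  case 0
  then show ?case by (simp add: continuous_on_mult)
next
  case (Suc k)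
  have d: "(f has_derivative frechet_derivative f (at x)) (at x)"
    "(g has_derivative frechet_derivative g (at x)) (at x)" for x
    using Suc.prems by (auto simp: frechet_derivative_works)
  have "partial_derivative i (\<lambda>x. f x * g x) =
      (\<lambda>x. f x * partial_derivative i g x + partial_derivative i f x * g x)" for i
    by (rule ext, subst partial_derivativeI[OF has_derivative_mult[OF d]])
      (simp add: partial_derivative_def)
  \<comment> \<open>The product rule keeps undifferentiated factors, so \<open>f\<close> and
    \<open>g\<close> are also needed with one order of smoothness less.\<close>
  with Suc Suc.prems[THEN Ck_function_Suc_imp] show ?case
    by (auto intro!: differentiable_mult Ck_function_add)
qed

text \<open>For \<open>m = 0\<close> this is the classical smooth function exp(-1/t) that is flat at
  0. The powers of 1/t make the family closed under differentiation up to linear combinations, so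
  smoothness can be proved by induction.\<close>

definition flat_exp :: "nat \<Rightarrow> real \<Rightarrow> real" where
  "flat_exp m t = (if t > 0 then (1 / t) ^ m * exp (- (1 / t)) else 0)"

lemma flat_exp_nonneg: "flat_exp m t \<ge> 0"
  by (simp add: flat_exp_def)

lemma flat_exp_pos_iff: "flat_exp m t > 0 \<longleftrightarrow> t > 0"
  by (simp add: flat_exp_def)

lemma DERIV_flat_exp:
  "(flat_exp m has_real_derivative flat_exp (m + 2) t - m * flat_exp (m + 1) t) (at t)"
proof (cases t "0::real" rule: linorder_cases)
  case less
  have "((\<lambda>x. 0) has_real_derivative 0) (at t)" by simp
  then have "(flat_exp m has_real_derivative 0) (at t)"
    by (rule has_field_derivative_transform_within_open[where S = "{..<0}"])
      (use less in \<open>auto simp: flat_exp_def\<close>)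
  with less show ?thesis by (simp add: flat_exp_def)
next
  case greater
  have "((\<lambda>x. inverse x ^ m * exp (- inverse x)) has_real_derivative
      inverse t ^ m * (exp (- inverse t) * (inverse t)\<^sup>2)
        + (m * inverse t ^ (m - 1) * - (inverse t)\<^sup>2) * exp (- inverse t)) (at t)"
    using greater by (auto intro!: derivative_eq_intros simp: power2_eq_square)
  \<comment> \<open>The case split handles the truncated subtraction \<open>m - 1\<close> at
    \<open>m = 0\<close>, where the factor \<open>m\<close> kills the term.\<close>
  also have "m * inverse t ^ (m - 1) * - (inverse t)\<^sup>2 = - (m * inverse t ^ (m + 1))"
    by (cases m) (simp_all add: power2_eq_square mult_ac)
  also have "inverse t ^ m * (exp (- inverse t) * (inverse t)\<^sup>2)
        + - (m * inverse t ^ (m + 1)) * exp (- inverse t) = flat_exp (m + 2) t - m * flat_exp (m + 1) t"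
    using greater by (simp add: flat_exp_def inverse_eq_divide power2_eq_square)
  finally have "((\<lambda>x. (1 / x) ^ m * exp (- (1 / x))) has_real_derivative
      flat_exp (m + 2) t - m * flat_exp (m + 1) t) (at t)"
    by (simp add: inverse_eq_divide)
  then show ?thesis
    by (rule has_field_derivative_transform_within_open[where S = "{0<..}"])
      (use greater in \<open>auto simp: flat_exp_def\<close>)
next
  case equal
  \<comment> \<open>At 0 the difference quotient from the right is s^(m+1) / exp s with s = 1/t, and
    the exponential wins as s tends to infinity. From the left it is 0.\<close>
  have "((\<lambda>x. x ^ Suc m / exp x) \<longlongrightarrow> 0) (at_top :: real filter)"
    by (rule tendsto_power_div_exp_0)
  then have "((\<lambda>t. inverse t ^ Suc m / exp (inverse t)) \<longlongrightarrow> (0::real)) (at_right 0)"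
    by (rule filterlim_compose[OF _ filterlim_inverse_at_top_right])
  then have "((\<lambda>t. flat_exp m t / t) \<longlongrightarrow> 0) (at_right 0)"
    by (rule Lim_transform_eventually)
      (auto simp: flat_exp_def eventually_at_filter field_simps exp_minus)
  moreover have "((\<lambda>t. flat_exp m t / t) \<longlongrightarrow> 0) (at_left 0)"
    by (rule Lim_transform_eventually[OF tendsto_const])
      (auto simp: flat_exp_def eventually_at_filter)
  ultimately show ?thesis
    using equal by (simp add: DERIV_def filterlim_at_split flat_exp_def)
qed

text \<open>The squared norm is a polynomial, so the composition is smooth at the centre too. Each
  derivative raises the index of \<open>flat_exp\<close>, which is why the induction on
  \<open>k\<close> leaves \<open>m\<close> arbitrary.\<close>

lemma Ck_function_flat_exp_ball:
  "Ck_function k (\<lambda>y :: real ^ 'n. flat_exp m (e - (norm (y - a))\<^sup>2))"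
proof (induction k arbitrary: m)
  case 0
  have "continuous_on UNIV (flat_exp m)"
    using DERIV_flat_exp DERIV_isCont continuous_at_imp_continuous_on by blast
  then show ?case
    by (auto intro!: continuous_on_compose2[of UNIV "flat_exp m"] continuous_intros)
next
  case (Suc k)
  let ?D = "\<lambda>y. flat_exp (m + 2) (e - (norm (y - a))\<^sup>2) + - real m * flat_exp (m + 1) (e - (norm (y - a))\<^sup>2)"
  have d: "((\<lambda>y. flat_exp m (e - (norm (y - a))\<^sup>2)) has_derivative
     (\<lambda>h. (- 2 * ((y - a) \<bullet> h)) * ?D y)) (at y)" for y
    unfolding power2_norm_eq_inner
    apply (rule has_derivative_eq_rhs)
     apply (rule DERIV_compose_FDERIV[OF DERIV_flat_exp])
     apply (auto intro!: derivative_eq_intros simp: inner_commute algebra_simps)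
    done
  have p: "partial_derivative i (\<lambda>y. flat_exp m (e - (norm (y - a))\<^sup>2)) =
      (\<lambda>y. (- 2 * (y $ i + - a $ i)) * ?D y)" for i
    by (rule ext, subst partial_derivativeI[OF d]) (simp add: inner_axis)
  have c: "Ck_function k (\<lambda>y :: real ^ 'n. y $ i)" for i
  proof (cases k)
    case 0
    then show ?thesis by (auto intro!: continuous_intros)
  next
    case (Suc l)
    have d: "((\<lambda>y :: real ^ 'n. y $ i) has_derivative (\<lambda>h. h $ i)) (at y)" for y
      by (intro bounded_linear_imp_has_derivative bounded_linear_vec_nth)
    have "partial_derivative j (\<lambda>y :: real ^ 'n. y $ i) = (\<lambda>y. axis j 1 $ i)" for j
      by (rule ext, rule partial_derivativeI[OF d])
    then show ?thesis using d Suc by (auto simp: Ck_function_const differentiable_def)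
  qed
  show ?case
    unfolding Ck_function.simps p
  proof (intro conjI allI)
    show "(\<lambda>y. flat_exp m (e - (norm (y - a))\<^sup>2)) differentiable at y" for y
      by (rule differentiableI[OF d])
    show "Ck_function k (\<lambda>y. (- 2 * (y $ i + - a $ i)) * ?D y)" for i
      by (rule Ck_function_mult Ck_function_add Ck_function_const c Suc.IH)+
  qed
qed

lemma test_function_flat_exp_ball:
  assumes "r > 0" "cball a r \<subseteq> U"
  shows "test_function U (\<lambda>y :: real ^ 'n. flat_exp 0 (r\<^sup>2 - (norm (y - a))\<^sup>2))"
proof -
  have "{y. flat_exp 0 (r\<^sup>2 - (norm (y - a))\<^sup>2) \<noteq> 0} \<subseteq> cball a r"
  proof
    fix y assume "y \<in> {y. flat_exp 0 (r\<^sup>2 - (norm (y - a))\<^sup>2) \<noteq> 0}"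
    then have "(norm (y - a))\<^sup>2 < r\<^sup>2"
      by (simp add: flat_exp_def split: if_splits)
    then show "y \<in> cball a r"
      using assms(1) power2_less_imp_less[of "norm (y - a)" r]
      by (simp add: dist_norm norm_minus_commute)
  qed
  then have s: "closure {y. flat_exp 0 (r\<^sup>2 - (norm (y - a))\<^sup>2) \<noteq> 0} \<subseteq> cball a r"
    by (simp add: closure_minimal)
  have "compact (closure {y. flat_exp 0 (r\<^sup>2 - (norm (y - a))\<^sup>2) \<noteq> 0})"
    using s by (meson bounded_cball bounded_subset closed_closure compact_eq_bounded_closed)
  then show ?thesis
    using s assms(2) by (auto simp: test_function_def Ck_function_flat_exp_ball)
qed

section \<open>Test functions\<close>

lemma eq_0_outside_support: "x \<notin> closure {x. \<phi> x \<noteq> 0} \<Longrightarrow> \<phi> x = 0"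
  using closure_subset[of "{x. \<phi> x \<noteq> 0}"] by (metis (mono_tags, lifting) mem_Collect_eq subsetD)

lemma partial_derivative_eq_0:
  assumes "x \<notin> closure {x. \<phi> x \<noteq> 0}"
  shows "partial_derivative i \<phi> x = 0"
proof -
  have "((\<lambda>x. 0) has_derivative (\<lambda>h. 0)) (at x)" by (rule has_derivative_const)
  then have "(\<phi> has_derivative (\<lambda>h. 0)) (at x)"
  proof (rule has_derivative_transform_within_open)
    show "0 = \<phi> y" if "y \<in> - closure {x. \<phi> x \<noteq> 0}" for y
      using that eq_0_outside_support[of y \<phi>] by simp
  qed (use assms in \<open>simp_all add: open_Compl\<close>)
  from partial_derivativeI[OF this] show ?thesis .
qed

lemma test_function_differentiable:
  assumes "test_function U \<phi>"
  shows "\<phi> differentiable (at x)"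
proof -
  have "Ck_function (Suc 0) \<phi>" using assms unfolding test_function_def by blast
  then show ?thesis by (simp only: Ck_function.simps)
qed

lemma test_function_continuous:
  assumes "test_function U \<phi>"
  shows "continuous_on UNIV \<phi>"
proof -
  have "Ck_function 0 \<phi>" using assms unfolding test_function_def by blast
  then show ?thesis by (simp only: Ck_function.simps)
qed

lemma test_function_continuous_partial:
  assumes "test_function U \<phi>"
  shows "continuous_on UNIV (partial_derivative i \<phi>)"
proof -
  have "Ck_function (Suc 0) \<phi>" using assms unfolding test_function_def by blast
  then show ?thesis by (simp only: Ck_function.simps)
qed

lemma test_function_support:
  assumes "test_function U \<phi>"
  obtains R where "\<And>x. norm x > R \<Longrightarrow> \<phi> x = 0"
    "\<And>x i. norm x > R \<Longrightarrow> partial_derivative i \<phi> x = 0"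
proof -
  have "bounded (closure {x. \<phi> x \<noteq> 0})"
    using assms unfolding test_function_def by (blast intro: compact_imp_bounded)
  then obtain R where R: "\<And>x. x \<in> closure {x. \<phi> x \<noteq> 0} \<Longrightarrow> norm x \<le> R"
    unfolding bounded_iff by blast
  have x: "x \<notin> closure {x. \<phi> x \<noteq> 0}" if "norm x > R" for x
    using R[of x] that by linarith
  show ?thesis
  proof (rule that)
    show "\<phi> x = 0" if "norm x > R" for x
      using x[OF that] by (rule eq_0_outside_support)
    show "partial_derivative i \<phi> x = 0" if "norm x > R" for x i
      using x[OF that] by (rule partial_derivative_eq_0)
  qed
qed

section \<open>Integrals against translated test functions\<close>

lemma integrable_continuous_compact_support:
  fixes g :: "'a::euclidean_space \<Rightarrow> real"
  assumes "continuous_on UNIV g" "compact S" "\<And>x. x \<notin> S \<Longrightarrow> g x = 0"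
  shows "integrable lborel g"
proof -
  have "integrable lborel (\<lambda>x. indicator S x *\<^sub>R g x)"
    using assms by (intro borel_integrable_compact continuous_on_subset[OF assms(1)]) auto
  also have "(\<lambda>x. indicator S x *\<^sub>R g x) = g"
    using assms(3) by (auto simp: fun_eq_iff indicator_def)
  finally show ?thesis .
qed

text \<open>Links the gauge integral over a box, for which the Leibniz rule is stated, to the
  Lebesgue integral over the whole space.\<close>

lemma integral_cbox_eq_lborel:
  fixes g :: "'a::euclidean_space \<Rightarrow> real"
  assumes "continuous_on UNIV g" "\<And>x. x \<notin> cbox a b \<Longrightarrow> g x = 0"
  shows "integral (cbox a b) g = (LINT x|lborel. g x)"
proof -
  have "integral (cbox a b) g = integral UNIV (\<lambda>x. if x \<in> cbox a b then g x else 0)"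
    by (rule integral_restrict_UNIV[symmetric])
  also have "(\<lambda>x. if x \<in> cbox a b then g x else 0) = g"
    using assms(2) by auto
  finally show ?thesis
    using integral_lborel[OF integrable_continuous_compact_support[OF assms(1) compact_cbox assms(2)]]
    by simp
qed

text \<open>Differentiation under the integral sign. The shift sits on the smooth factor
  \<open>\<phi>\<close>, so continuity of \<open>f\<close> is enough.\<close>

lemma has_real_derivative_integral_translate:
  fixes f :: "real ^ 'n \<Rightarrow> real"
  assumes f: "continuous_on UNIV f" and \<phi>: "test_function U \<phi>"
  shows "((\<lambda>h. LINT y|lborel. f y * \<phi> (y - h *\<^sub>R axis i 1)) has_real_derivative
     - (LINT y|lborel. f y * partial_derivative i \<phi> (y - s *\<^sub>R axis i 1))) (at s)"
proof -
  obtain R where R: "\<And>x. norm x > R \<Longrightarrow> \<phi> x = 0"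
    "\<And>x i. norm x > R \<Longrightarrow> partial_derivative i \<phi> x = 0"
    using test_function_support[OF \<phi>] by blast
  let ?e = "axis i 1 :: real ^ 'n" and ?I = "{s - 1<..<s + 1}"
  \<comment> \<open>One box must contain the supports of all translates with \<open>h\<close> in
    \<open>?I\<close>. Such shifts have length at most \<open>\<bar>s\<bar> + 1\<close>, whence the
    radius.\<close>
  obtain a :: "real ^ 'n" where a: "cball 0 (R + \<bar>s\<bar> + 1) \<subseteq> cbox (- a) a"
    using bounded_subset_cbox_symmetric[OF bounded_cball] by blast
  have out: "norm (y - h *\<^sub>R ?e) > R" if "h \<in> ?I" "y \<notin> cbox (- a) a" for y h
  proof -
    have "norm y > R + \<bar>s\<bar> + 1" using a that(2) by (force simp: subset_iff)
    moreover have "\<bar>h\<bar> \<le> \<bar>s\<bar> + 1" using that by auto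
    moreover have "norm y \<le> norm (y - h *\<^sub>R ?e) + \<bar>h\<bar>"
      using norm_triangle_ineq[of "y - h *\<^sub>R ?e" "h *\<^sub>R ?e"] by simp
    ultimately show ?thesis by linarith
  qed
  note c = test_function_continuous[OF \<phi>] test_function_continuous_partial[OF \<phi>, of i]
  have cint: "continuous_on UNIV (\<lambda>y. f y * \<phi> (y - h *\<^sub>R ?e))"
    "continuous_on UNIV (\<lambda>y. f y * partial_derivative i \<phi> (y - h *\<^sub>R ?e))" for h
    by (auto intro!: continuous_intros f continuous_on_compose2[OF c(1)] continuous_on_compose2[OF c(2)])
  have "((\<lambda>h. integral (cbox (- a) a) (\<lambda>y. f y * \<phi> (y - h *\<^sub>R ?e))) has_real_derivative
     integral (cbox (- a) a) (\<lambda>y. - (f y * partial_derivative i \<phi> (y - s *\<^sub>R ?e)))) (at s within ?I)"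
  proof (rule leibniz_rule_field_derivative[where
        fx = "\<lambda>h y. - (f y * partial_derivative i \<phi> (y - h *\<^sub>R ?e))"])
    fix h and y
    have d1: "((\<lambda>h. y - h *\<^sub>R ?e) has_derivative (\<lambda>k. - (k *\<^sub>R ?e))) (at h within ?I)"
      by (auto intro!: derivative_eq_intros)
    have d2: "(\<phi> has_derivative frechet_derivative \<phi> (at (y - h *\<^sub>R ?e))) (at (y - h *\<^sub>R ?e))"
      using test_function_differentiable[OF \<phi>] by (simp add: frechet_derivative_works)
    note d = has_derivative_compose[OF d1 d2]
    have "linear (frechet_derivative \<phi> (at (y - h *\<^sub>R ?e)))"
      using test_function_differentiable[OF \<phi>] by (rule linear_frechet_derivative)
    then have "(\<lambda>k. frechet_derivative \<phi> (at (y - h *\<^sub>R ?e)) (- (k *\<^sub>R ?e))) =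
        (*) (- partial_derivative i \<phi> (y - h *\<^sub>R ?e))"
      by (auto simp: partial_derivative_def linear_neg linear_scale)
    with d have "((\<lambda>h. \<phi> (y - h *\<^sub>R ?e)) has_real_derivative
        - partial_derivative i \<phi> (y - h *\<^sub>R ?e)) (at h within ?I)"
      by (simp add: has_field_derivative_def)
    from DERIV_cmult[OF this]
    show "((\<lambda>h. f y * \<phi> (y - h *\<^sub>R ?e)) has_real_derivative
        - (f y * partial_derivative i \<phi> (y - h *\<^sub>R ?e))) (at h within ?I)"
      by simp
  next
    show "continuous_on (?I \<times> cbox (- a) a)
        (\<lambda>(h, y). - (f y * partial_derivative i \<phi> (y - h *\<^sub>R ?e)))"
      unfolding case_prod_beta
      by (intro continuous_intros continuous_on_compose2[OF f] continuous_on_compose2[OF c(2)]) auto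
  qed (auto intro!: integrable_continuous continuous_on_subset[OF cint(1)])
  then have d: "((\<lambda>h. integral (cbox (- a) a) (\<lambda>y. f y * \<phi> (y - h *\<^sub>R ?e))) has_real_derivative
     - integral (cbox (- a) a) (\<lambda>y. f y * partial_derivative i \<phi> (y - s *\<^sub>R ?e))) (at s)"
    by (simp add: at_within_open[of s ?I])
  have i1: "integral (cbox (- a) a) (\<lambda>y. f y * \<phi> (y - h *\<^sub>R ?e)) =
      (LINT y|lborel. f y * \<phi> (y - h *\<^sub>R ?e))" if "h \<in> ?I" for h
    by (rule integral_cbox_eq_lborel[OF cint(1)]) (simp add: R(1) out[OF that])
  have i2: "integral (cbox (- a) a) (\<lambda>y. f y * partial_derivative i \<phi> (y - s *\<^sub>R ?e)) =
      (LINT y|lborel. f y * partial_derivative i \<phi> (y - s *\<^sub>R ?e))"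
    by (rule integral_cbox_eq_lborel[OF cint(2)]) (simp add: R(2) out[of s])
  show ?thesis
    by (rule has_field_derivative_transform_within_open[OF d[unfolded i2], where S = ?I])
      (simp_all add: i1)
qed

section \<open>Weak derivatives of continuous functions along segments\<close>

text \<open>The subset of \<open>U\<close> on which \<open>f\<close> exceeds \<open>B\<close> is
  open and null, hence empty.\<close>

lemma AE_le_imp_le_on_open:
  fixes f :: "'a::euclidean_space \<Rightarrow> real"
  assumes "continuous_on U f" "open U" and ae: "AE x in lebesgue_on U. f x \<le> B" and "x \<in> U"
  shows "f x \<le> B"
proof (rule ccontr)
  assume "\<not> f x \<le> B"
  let ?V = "U \<inter> f -` {B<..}"
  have "open ?V"
    using assms by (intro continuous_open_preimage) auto
  moreover have "x \<in> ?V" using \<open>x \<in> U\<close> \<open>\<not> f x \<le> B\<close> by simp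
  moreover have "AE x in lebesgue. x \<notin> ?V"
    using ae \<open>open U\<close> by (subst (asm) AE_restrict_space_iff) (auto elim!: eventually_mono)
  then have "negligible ?V"
    using \<open>open ?V\<close> by (simp add: negligible_iff_null_sets AE_iff_null_sets)
  ultimately show False
    using open_not_negligible by blast
qed

lemma lborel_integral_translation:
  fixes g :: "'a::euclidean_space \<Rightarrow> real"
  assumes "g \<in> borel_measurable borel"
  shows "(LINT x|lborel. g (x + c)) = (LINT x|lborel. g x)"
proof -
  have "(LINT x|lborel. g x) = (LINT x|distr lborel borel ((+) c). g x)"
    by (simp only: lborel_distr_plus)
  also have "\<dots> = (LINT x|lborel. g (c + x))"
    using assms by (intro integral_distr) auto
  finally show ?thesis by (simp add: add.commute)
qed

text \<open>The definition of the weak derivative moves the derivative from \<open>\<phi>\<close> to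
  \<open>g\<close>, which is at most \<open>M\<close> in absolute value. Both integrands vanish off
  \<open>U\<close>, so integrals over \<open>U\<close> become integrals over the whole
  space.\<close>

lemma weak_partial_derivative_bound:
  fixes f :: "real ^ 'n \<Rightarrow> real"
  assumes U: "open U" and f: "continuous_on UNIV f" and g: "weak_partial_derivative U i f g"
    and M: "AE x in lebesgue_on U. \<bar>g x\<bar> \<le> M"
    and \<phi>: "test_function U \<phi>" and pos: "\<And>x. \<phi> x \<ge> 0"
  shows "\<bar>LINT x|lborel. f x * partial_derivative i \<phi> x\<bar> \<le> M * (LINT x|lborel. \<phi> x)"
proof -
  let ?d = "partial_derivative i \<phi>"
  have supp: "closure {x. \<phi> x \<noteq> 0} \<subseteq> U" "compact (closure {x. \<phi> x \<noteq> 0})"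
    using \<phi> by (auto simp: test_function_def)
  have "?d x = 0" if "x \<notin> U" for x
    using that supp(1) by (intro partial_derivative_eq_0) blast
  then have eq: "(\<lambda>x. indicator U x *\<^sub>R (f x * ?d x)) = (\<lambda>x. f x * ?d x)"
    by (auto simp: fun_eq_iff indicator_def)
  have "(\<lambda>x. f x * ?d x) \<in> borel_measurable borel"
    using f test_function_continuous_partial[OF \<phi>]
    by (intro borel_measurable_continuous_onI continuous_on_mult)
  then have "(LINT x|lborel. f x * ?d x) = (LINT x:U|lebesgue. f x * ?d x)"
    unfolding set_lebesgue_integral_def eq by (intro integral_completion[symmetric]) simp
  also have "\<dots> = - (LINT x:U|lebesgue. g x * \<phi> x)"
    using g \<phi> unfolding weak_partial_derivative_def by blast
  finally have "\<bar>LINT x|lborel. f x * ?d x\<bar> = \<bar>LINT x|lebesgue. indicator U x *\<^sub>R (g x * \<phi> x)\<bar>"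
    by (simp add: set_lebesgue_integral_def)
  also have "\<dots> \<le> (LINT x|lebesgue. \<bar>indicator U x *\<^sub>R (g x * \<phi> x)\<bar>)"
    by (rule integral_abs_bound)
  also have "\<dots> \<le> (LINT x|lebesgue. M * \<phi> x)"
  proof (rule integral_mono_AE')
    have "integrable lborel \<phi>"
      by (rule integrable_continuous_compact_support[OF test_function_continuous[OF \<phi>] supp(2)
          eq_0_outside_support[of _ \<phi>]])
    then show "integrable lebesgue (\<lambda>x. M * \<phi> x)"
      by (intro integrable_mult_right) (simp add: integrable_completion)
    have "AE x in lebesgue. x \<in> U \<longrightarrow> \<bar>g x\<bar> \<le> M"
      using M U by (simp add: AE_restrict_space_iff)
    then show ae: "AE x in lebesgue. \<bar>indicator U x *\<^sub>R (g x * \<phi> x)\<bar> \<le> M * \<phi> x"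
    proof eventually_elim
      case (elim x)
      show ?case
      proof (cases "x \<in> U")
        case True
        with elim pos[of x] show ?thesis by (simp add: abs_mult mult_right_mono)
      next
        case False
        with supp(1) eq_0_outside_support[of x \<phi>] have "\<phi> x = 0" by blast
        with False show ?thesis by simp
      qed
    qed
    \<comment> \<open>No sign of \<open>M\<close> is given; nonnegativity follows from the bound
      just shown.\<close>
    then show "AE x in lebesgue. 0 \<le> M * \<phi> x"
      by eventually_elim linarith
  qed
  also have "\<dots> = M * (LINT x|lborel. \<phi> x)"
    using test_function_continuous[OF \<phi>]
    by (simp add: integral_completion borel_measurable_continuous_onI)
  finally show ?thesis .
qed

text \<open>A bump is slid along the segment and \<open>f\<close> is integrated against it. By the
  mean value theorem the change of this average is at most \<open>M * t\<close> times the integral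
  of the bump. If the increment of \<open>f\<close> at \<open>x\<close> were larger, it would by
  continuity be larger on the whole support of a small bump, a contradiction.\<close>

lemma weak_partial_derivative_segment_bound:
  fixes f :: "real ^ 'n \<Rightarrow> real"
  assumes U: "open U" and f: "continuous_on UNIV f" and g: "weak_partial_derivative U i f g"
    and M: "AE x in lebesgue_on U. \<bar>g x\<bar> \<le> M"
    and t: "t > 0" and seg: "\<And>s. 0 \<le> s \<Longrightarrow> s \<le> t \<Longrightarrow> x + s *\<^sub>R axis i 1 \<in> U"
  shows "\<bar>f (x + t *\<^sub>R axis i 1) - f x\<bar> \<le> M * t"
proof (rule ccontr)
  let ?e = "axis i 1 :: real ^ 'n"
  define D where "D y = f (y + t *\<^sub>R ?e) - f y" for y
  \<comment> \<open>The sign \<open>\<sigma>\<close> reduces both signs of the increment to one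
    case; the midpoint \<open>m\<close> leaves strict room on both sides.\<close>
  define \<sigma> where "\<sigma> = sgn (D x)"
  define m where "m = (\<bar>D x\<bar> + M * t) / 2"
  assume "\<not> ?thesis"
  then have m: "M * t < m" "m < \<sigma> * D x"
    by (auto simp: m_def D_def \<sigma>_def abs_sgn mult.commute)
  have D: "continuous_on UNIV D"
    unfolding D_def by (intro continuous_intros continuous_on_compose2[OF f]) auto
  have "open {y. m < \<sigma> * D y}"
    by (intro open_Collect_less continuous_intros D)
  then obtain \<delta> where \<delta>: "\<delta> > 0" "\<And>y. y \<in> ball x \<delta> \<Longrightarrow> m < \<sigma> * D y"
    using m(2) by (auto simp: open_contains_ball subset_iff)
  have "compact ((\<lambda>s. x + s *\<^sub>R ?e) ` {0..t})"
    by (intro compact_continuous_image continuous_intros) auto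
  then obtain \<epsilon> where \<epsilon>: "\<epsilon> > 0" "(\<Union>y\<in>(\<lambda>s. x + s *\<^sub>R ?e) ` {0..t}. ball y \<epsilon>) \<subseteq> U"
    by (rule compact_subset_open_imp_ball_epsilon_subset[OF _ U]) (use seg in auto)
  \<comment> \<open>Staying below \<open>\<delta>\<close> keeps the sign-corrected increment above
    \<open>m\<close> on the support of the bump; staying below \<open>\<epsilon>\<close> keeps the
    sliding bump inside \<open>U\<close>.\<close>
  define r where "r = min \<delta> \<epsilon> / 2"
  have r: "r > 0" "r < \<delta>" "r < \<epsilon>"
    using \<delta>(1) \<epsilon>(1) by (auto simp: r_def)
  define \<psi> where "\<psi> = (\<lambda>y. flat_exp 0 (r\<^sup>2 - (norm (y - x))\<^sup>2))"
  have \<psi>_eq: "\<psi> (y - s *\<^sub>R ?e) = flat_exp 0 (r\<^sup>2 - (norm (y - (x + s *\<^sub>R ?e)))\<^sup>2)" for y s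
    by (simp add: \<psi>_def algebra_simps)
  have test: "test_function U (\<lambda>y. \<psi> (y - s *\<^sub>R ?e))" if "0 \<le> s" "s \<le> t" for s
    unfolding \<psi>_eq
  proof (rule test_function_flat_exp_ball[OF r(1)])
    show "cball (x + s *\<^sub>R ?e) r \<subseteq> U"
      using that \<epsilon>(2) r(3) by fastforce
  qed
  have test0: "test_function U \<psi>"
    using test[of 0] t by simp
  have \<psi>c: "continuous_on UNIV \<psi>"
    by (rule test_function_continuous[OF test0])
  have \<psi>0: "\<psi> y = 0" if "y \<notin> cball x r" for y
  proof -
    have "r\<^sup>2 \<le> (norm (y - x))\<^sup>2"
      using that r(1) by (intro power_mono) (auto simp: dist_norm norm_minus_commute)
    then show ?thesis by (simp add: \<psi>_def flat_exp_def)
  qed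
  have \<psi>nn: "\<psi> y \<ge> 0" for y
    by (simp add: \<psi>_def flat_exp_nonneg)
  have int: "integrable lborel (\<lambda>y. h y * \<psi> y)" if "continuous_on UNIV h" for h
    by (rule integrable_continuous_compact_support[where S = "cball x r"])
      (use that \<psi>c \<psi>0 in \<open>auto intro: continuous_on_mult\<close>)
  note int1 = int[of "\<lambda>_. 1", simplified]
  define F where "F s = (LINT y|lborel. f y * \<psi> (y - s *\<^sub>R ?e))" for s
  have "\<exists>F'. (F has_real_derivative F') (at s) \<and> \<bar>F'\<bar> \<le> M * (LINT y|lborel. \<psi> y)"
    if s: "0 \<le> s" "s \<le> t" for s
  proof (intro exI conjI)
    let ?\<phi> = "\<lambda>y. \<psi> (y - s *\<^sub>R ?e)"
    let ?F' = "LINT y|lborel. f y * partial_derivative i ?\<phi> y"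
    \<comment> \<open>The derivative at \<open>s\<close> is that at 0 for the already translated
      bump \<open>?\<phi>\<close>, a test function on \<open>U\<close> to which the weak derivative
      bound applies.\<close>
    have "((\<lambda>h. F (h + s)) has_real_derivative - ?F') (at 0)"
      using has_real_derivative_integral_translate[OF f test[OF s], of i 0]
      by (simp add: F_def algebra_simps)
    then show "(F has_real_derivative - ?F') (at s)"
      by (subst (asm) DERIV_shift[symmetric]) simp
    have "\<bar>?F'\<bar> \<le> M * (LINT y|lborel. ?\<phi> y)"
      by (rule weak_partial_derivative_bound[OF U f g M test[OF s] \<psi>nn])
    also have "(LINT y|lborel. ?\<phi> y) = (LINT y|lborel. \<psi> y)"
      using lborel_integral_translation[OF borel_measurable_continuous_onI[OF \<psi>c], of "- s *\<^sub>R ?e"]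
      by simp
    finally show "\<bar>- ?F'\<bar> \<le> M * (LINT y|lborel. \<psi> y)" by simp
  qed
  then obtain F' where F': "\<And>s. 0 \<le> s \<Longrightarrow> s \<le> t \<Longrightarrow> (F has_real_derivative F' s) (at s)"
      "\<And>s. 0 \<le> s \<Longrightarrow> s \<le> t \<Longrightarrow> \<bar>F' s\<bar> \<le> M * (LINT y|lborel. \<psi> y)"
    by metis
  obtain z where z: "0 < z" "z < t" "F t - F 0 = (t - 0) * F' z"
    using MVT2[OF t, of F F'] F'(1) by blast
  \<comment> \<open>Translation invariance moves the shift from \<open>\<psi>\<close> to
    \<open>f\<close>, so that \<open>F t - F 0\<close> becomes the average of the increment
    \<open>D\<close>.\<close>
  have "F t = (LINT y|lborel. f (y + t *\<^sub>R ?e) * \<psi> y)"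
  proof -
    have "(\<lambda>y. f (y + t *\<^sub>R ?e) * \<psi> y) \<in> borel_measurable borel"
      by (intro borel_measurable_continuous_onI continuous_intros \<psi>c continuous_on_compose2[OF f]) auto
    from lborel_integral_translation[OF this, of "- t *\<^sub>R ?e"] show ?thesis
      by (simp add: F_def)
  qed
  moreover have "continuous_on UNIV (\<lambda>y. f (y + t *\<^sub>R ?e))"
    by (intro continuous_intros continuous_on_compose2[OF f]) auto
  ultimately have FD: "F t - F 0 = (LINT y|lborel. D y * \<psi> y)"
    using int f by (simp add: F_def D_def left_diff_distrib)
  have "m * (LINT y|lborel. \<psi> y) = (LINT y|lborel. m * \<psi> y)" by simp
  also have "\<dots> \<le> (LINT y|lborel. \<sigma> * (D y * \<psi> y))"
  proof (rule integral_mono)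
    show "m * \<psi> y \<le> \<sigma> * (D y * \<psi> y)" for y
    proof (cases "y \<in> cball x r")
      case True
      then have "m < \<sigma> * D y" using r by (intro \<delta>(2)) auto
      from mult_right_mono[OF less_imp_le[OF this] \<psi>nn[of y]] show ?thesis
        by (simp add: mult.assoc)
    qed (simp add: \<psi>0)
  qed (use int1 int[OF D] in auto)
  also have "\<dots> = \<sigma> * (F t - F 0)" by (simp add: FD)
  also have "\<dots> \<le> \<bar>F t - F 0\<bar>"
    by (auto simp: \<sigma>_def sgn_if)
  also have "\<dots> = t * \<bar>F' z\<bar>" using z t by (simp add: abs_mult)
  also have "\<dots> \<le> t * (M * (LINT y|lborel. \<psi> y))"
    using F'(2)[of z] z t by (intro mult_left_mono) auto
  \<comment> \<open>As \<open>m\<close> exceeds \<open>M * t\<close>, the nonnegative continuous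
    bump has integral 0 and so vanishes everywhere, although it is positive at its centre.\<close>
  finally have "(m - M * t) * (LINT y|lborel. \<psi> y) \<le> 0"
    by (simp add: algebra_simps)
  then have "(LINT y|lborel. \<psi> y) \<le> 0"
    using m(1) by (simp add: mult_le_0_iff)
  moreover have "(LINT y|lborel. \<psi> y) \<ge> 0"
    by (rule Bochner_Integration.integral_nonneg) (simp add: \<psi>nn)
  ultimately have "(LINT y|lborel. \<psi> y) = 0" by simp
  then have "AE y in lborel. \<psi> y = 0"
    using int1 \<psi>nn by (subst (asm) integral_nonneg_eq_0_iff_AE) auto
  then have "AE y in lebesgue. \<psi> y = 0"
    by (rule AE_completion)
  then have "AE y in lebesgue_on UNIV. \<psi> y \<le> 0"
    by (subst AE_restrict_space_iff) auto
  from AE_le_imp_le_on_open[OF \<psi>c open_UNIV this, of x] have "\<psi> x \<le> 0" by simp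
  moreover have "\<psi> x > 0"
    using r(1) by (simp add: \<psi>_def flat_exp_pos_iff)
  ultimately show False by simp
qed

section \<open>Weak limits of bounded sequences\<close>

text \<open>Dyadic averages of the terms from index \<open>m\<close> on. Closure under midpoints is
  all the convexity that the parallelogram law requires, and properties preserved by averaging
  follow by rule induction.\<close>

inductive_set tail_midpoints :: "(nat \<Rightarrow> 'a \<Rightarrow> real) \<Rightarrow> nat \<Rightarrow> ('a \<Rightarrow> real) set"
  for u :: "nat \<Rightarrow> 'a \<Rightarrow> real" and m :: nat where
  tail: "m \<le> k \<Longrightarrow> u k \<in> tail_midpoints u m"
| midpoint: "a \<in> tail_midpoints u m \<Longrightarrow> b \<in> tail_midpoints u m \<Longrightarrow>
    (\<lambda>x. (a x + b x) / 2) \<in> tail_midpoints u m"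

lemma tail_midpoints_antimono:
  assumes "m \<le> n"
  shows "tail_midpoints u n \<subseteq> tail_midpoints u m"
proof
  show "a \<in> tail_midpoints u m" if "a \<in> tail_midpoints u n" for a
    using that by induction (use assms in \<open>auto intro: tail_midpoints.intros\<close>)
qed

lemma tail_midpoints_measurable:
  assumes "\<And>k. u k \<in> borel_measurable M" and "a \<in> tail_midpoints u m"
  shows "a \<in> borel_measurable M"
  using assms(2) by induction (use assms(1) in auto)

lemma tail_midpoints_bounded:
  assumes "\<And>k x. \<bar>u k x\<bar> \<le> L" and "a \<in> tail_midpoints u m"
  shows "\<bar>a x\<bar> \<le> (L :: real)"
  using assms(2)
proof induction
  case (midpoint a b)
  then show ?case by (simp add: abs_le_iff)
qed (rule assms(1))

text \<open>Being within \<open>e\<close> of \<open>l\<close> is a convex condition on the integral,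
  so it passes from the tail to its averages.\<close>

lemma tail_midpoints_integral:
  assumes "\<And>k. integrable M (\<lambda>x. u k x * \<phi> x)"
    and "\<And>k. k \<ge> m \<Longrightarrow> \<bar>(LINT x|M. u k x * \<phi> x) - l\<bar> \<le> e"
    and "a \<in> tail_midpoints u m"
  shows "integrable M (\<lambda>x. a x * \<phi> x) \<and> \<bar>(LINT x|M. a x * \<phi> x) - l\<bar> \<le> e"
  using assms(3)
proof induction
  case (tail k)
  then show ?case using assms(1,2) by blast
next
  case (midpoint a b)
  have eq: "(\<lambda>x. (a x + b x) / 2 * \<phi> x) = (\<lambda>x. (a x * \<phi> x + b x * \<phi> x) / 2)"
    by (simp add: fun_eq_iff algebra_simps)
  have "(LINT x|M. (a x + b x) / 2 * \<phi> x) = ((LINT x|M. a x * \<phi> x) + (LINT x|M. b x * \<phi> x)) / 2"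
    using midpoint.IH unfolding eq by simp
  moreover have "integrable M (\<lambda>x. (a x + b x) / 2 * \<phi> x)"
    using midpoint.IH unfolding eq by simp
  ultimately show ?case
    using midpoint.IH by (auto simp: abs_le_iff field_simps)
qed

text \<open>The density is a strictly positive function of finite integral. Under the new measure
  bounded measurable functions are square integrable, while almost everywhere keeps its
  meaning.\<close>

lemma (in sigma_finite_measure) finite_measure_same_null_sets:
  obtains N where "finite_measure N" "sets N = sets M" "\<And>P. (AE x in N. P x) \<longleftrightarrow> (AE x in M. P x)"
proof -
  obtain w where w: "w \<in> borel_measurable M" "integral\<^sup>N M w \<noteq> \<infinity>"
    and pos: "\<And>x. x \<in> space M \<Longrightarrow> 0 < w x"
    using Ex_finite_integrable_function by blast
  show ?thesis
  proof
    show "finite_measure (density M w)"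
    proof
      have "emeasure (density M w) (space M) = (\<integral>\<^sup>+x. w x \<partial>M)"
        using w(1) by (subst emeasure_density) (auto intro!: nn_integral_cong)
      then show "emeasure (density M w) (space (density M w)) \<noteq> \<infinity>"
        using w(2) by simp
    qed
    show "(AE x in density M w. P x) \<longleftrightarrow> (AE x in M. P x)" for P
      using pos by (simp add: AE_density[OF w(1)] cong: AE_cong)
  qed simp
qed

text \<open>On a finite measure space, Cauchy in L2 implies Cauchy in L1, and an L1-Cauchy sequence
  has an almost everywhere convergent subsequence. The first implication rests on the pointwise
  inequality |a| \<le> \<eta> + a^2 / \<eta>.\<close>

lemma (in finite_measure) Cauchy_L2_AE_convergent_subseq:
  fixes h :: "nat \<Rightarrow> 'a \<Rightarrow> real"
  assumes meas: "\<And>n. h n \<in> borel_measurable M" and bdd: "\<And>n x. \<bar>h n x\<bar> \<le> L"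
    and cauchy: "\<And>e. e > 0 \<Longrightarrow> \<exists>N. \<forall>m\<ge>N. \<forall>n\<ge>m. (LINT x|M. (h m x - h n x)\<^sup>2) < e"
  obtains r where "strict_mono r" "AE x in M. convergent (\<lambda>i. h (r i) x)"
proof -
  have int: "integrable M (h n)" for n
    by (rule integrable_const_bound[where B = L]) (use meas bdd in auto)
  have int2: "integrable M (\<lambda>x. (h m x - h n x)\<^sup>2)" for m n
  proof (rule integrable_const_bound[where B = "(2 * L)\<^sup>2"])
    have "\<bar>h m x - h n x\<bar> \<le> 2 * L" for x
      using bdd[of m x] bdd[of n x] by linarith
    from power_mono[OF this abs_ge_zero, where n = 2]
    show "AE x in M. norm ((h m x - h n x)\<^sup>2) \<le> (2 * L)\<^sup>2"
      by (intro AE_I2) (simp del: power_mult_distrib)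
  qed (use meas in measurable)
  have "\<exists>N. \<forall>i\<ge>N. \<forall>j\<ge>N. (LINT x|M. norm (h i x - h j x)) < e" if "e > 0" for e
  proof -
    \<comment> \<open>Adding 1 keeps \<open>c\<close> positive even for the zero measure. The choice
      of \<open>\<eta>\<close> makes each of the two error terms at most
      \<open>e / 2\<close>.\<close>
    define c where "c = measure M (space M) + 1"
    define \<eta> where "\<eta> = e / (2 * c)"
    have c: "c > 0" "measure M (space M) < c"
      unfolding c_def using measure_nonneg[of M "space M"] by linarith+
    have \<eta>: "\<eta> > 0" using that c by (simp add: \<eta>_def)
    then have "\<eta> * (e / 2) > 0" using that by simp
    from cauchy[OF this] obtain N
      where N: "\<And>m n. m \<ge> N \<Longrightarrow> n \<ge> m \<Longrightarrow> (LINT x|M. (h m x - h n x)\<^sup>2) < \<eta> * (e / 2)"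
      by blast
    have *: "(LINT x|M. norm (h m x - h n x)) < e" if mn: "m \<ge> N" "n \<ge> m" for m n
    proof -
      have "(LINT x|M. norm (h m x - h n x)) \<le> (LINT x|M. \<eta> + (h m x - h n x)\<^sup>2 / \<eta>)"
      proof (rule integral_mono)
        show "norm (h m x - h n x) \<le> \<eta> + (h m x - h n x)\<^sup>2 / \<eta>" for x
        proof (cases "\<bar>h m x - h n x\<bar> \<le> \<eta>")
          case True
          moreover have "(h m x - h n x)\<^sup>2 / \<eta> \<ge> 0" using \<eta> by simp
          ultimately show ?thesis unfolding real_norm_def by linarith
        next
          case False
          then have "\<bar>h m x - h n x\<bar> * \<eta> \<le> \<bar>h m x - h n x\<bar> * \<bar>h m x - h n x\<bar>"
            by (intro mult_left_mono) auto
          then have "\<bar>h m x - h n x\<bar> \<le> (h m x - h n x)\<^sup>2 / \<eta>"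
            using \<eta> by (simp add: pos_le_divide_eq power2_eq_square)
          with \<eta> show ?thesis by simp
        qed
      qed (use int int2 in auto)
      also have "\<dots> = \<eta> * measure M (space M) + (LINT x|M. (h m x - h n x)\<^sup>2) / \<eta>"
        using int2 by (simp add: mult.commute)
      also have "\<dots> \<le> \<eta> * c + (LINT x|M. (h m x - h n x)\<^sup>2) / \<eta>"
        using \<eta> c by simp
      also have "(LINT x|M. (h m x - h n x)\<^sup>2) / \<eta> < e / 2"
        using N[OF mn] \<eta> by (simp add: pos_divide_less_eq mult.commute)
      also have "\<eta> * c = e / 2" using c by (simp add: \<eta>_def)
      finally show ?thesis by simp
    qed
    have "(LINT x|M. norm (h i x - h j x)) < e" if "i \<ge> N" "j \<ge> N" for i j
      using *[of i j] *[of j i] that by (cases "i \<le> j") (auto simp: abs_minus_commute)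
    then show ?thesis by blast
  qed
  from cauchy_L1_AE_cauchy_subseq[OF int this] obtain r where
    "strict_mono r" "AE x in M. Cauchy (\<lambda>i. h (r i) x)" by blast
  then show ?thesis by (intro that) (auto simp: Cauchy_convergent_iff)
qed

text \<open>Near-minimisers of the L2 norm over averages of ever later tails converge almost
  everywhere along a subsequence. Whenever the integrals of \<open>u k\<close> against
  \<open>\<phi>\<close> converge, those of the averages have the same limit, and dominated
  convergence identifies it. One \<open>g\<close> serves all such \<open>\<phi>\<close>.\<close>

lemma (in sigma_finite_measure) bounded_weak_limit:
  fixes u :: "nat \<Rightarrow> 'a \<Rightarrow> real"
  assumes meas: "\<And>k. u k \<in> borel_measurable M" and bdd: "\<And>k x. \<bar>u k x\<bar> \<le> L"
  obtains g where "g \<in> borel_measurable M" "\<And>x. \<bar>g x\<bar> \<le> L"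
    "\<And>\<phi> l. integrable M \<phi> \<Longrightarrow> (\<lambda>k. LINT x|M. u k x * \<phi> x) \<longlonglongrightarrow> l \<Longrightarrow> (LINT x|M. g x * \<phi> x) = l"
proof -
  obtain N where N: "finite_measure N" and sets: "sets N = sets M"
    and AE: "\<And>P. (AE x in N. P x) \<longleftrightarrow> (AE x in M. P x)"
    using finite_measure_same_null_sets by blast
  interpret N: finite_measure N by (rule N)
  let ?H = "tail_midpoints u"
  define I where "I a = (LINT x|N. (a x)\<^sup>2)" for a :: "'a \<Rightarrow> real"
  define d where "d m = Inf (I ` ?H m)" for m
  have measH: "a \<in> borel_measurable N" if "a \<in> ?H m" for a m
    using tail_midpoints_measurable[OF meas that] sets by (simp cong: measurable_cong_sets)
  have bddH: "\<bar>a x\<bar> \<le> L" if "a \<in> ?H m" for a m x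
    using tail_midpoints_bounded[OF bdd that] .
  have sq: "(a x)\<^sup>2 \<le> L\<^sup>2" if "a \<in> ?H m" for a m x
    using bddH[OF that, of x] by (metis abs_ge_zero power2_abs power_mono)
  have int: "integrable N (\<lambda>x. a x * b x)" if "a \<in> ?H m" "b \<in> ?H n" for a b m n
  proof (rule N.integrable_const_bound[where B = "L * L"])
    show "AE x in N. norm (a x * b x) \<le> L * L"
      using bddH[OF that(1)] bddH[OF that(2)]
      by (intro AE_I2) (auto simp: abs_mult intro!: mult_mono order_trans[OF abs_ge_zero])
  qed (use measH that in auto)
  have I_le: "I a \<le> L\<^sup>2 * measure N (space N)" if "a \<in> ?H m" for a m
  proof -
    have "I a \<le> (LINT x|N. L\<^sup>2)"
      unfolding I_def using int[OF that that] sq[OF that]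
      by (intro integral_mono) (auto simp: power2_eq_square)
    then show ?thesis by (simp add: mult.commute)
  qed
  have bb: "bdd_below (I ` ?H m)" for m
    by (rule bdd_belowI[where m = 0]) (auto simp: I_def)
  have ne: "I ` ?H m \<noteq> {}" for m
    using tail_midpoints.tail[of m m u] by blast
  have d_le: "d m \<le> I a" if "a \<in> ?H m" for a m
    unfolding d_def using that bb by (intro cInf_lower) auto
  \<comment> \<open>Later tails have fewer averages, so the infima increase; being bounded, they
    converge.\<close>
  have "mono d"
    unfolding d_def by (intro monoI cInf_superset_mono ne bb image_mono tail_midpoints_antimono)
  moreover have "d m \<le> L\<^sup>2 * measure N (space N)" for m
    using d_le[OF tail_midpoints.tail[of m m u]] I_le[OF tail_midpoints.tail[of m m u]] by simp
  ultimately have "convergent d"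
    using incseq_convergent[of d] by (metis convergent_def)
  then have "Cauchy d" by (simp add: Cauchy_convergent_iff)
  \<comment> \<open>The infimum need not be attained, so \<open>h m\<close> is chosen within a slack
    \<open>q m\<close> that tends to 0.\<close>
  define q where "q m = 1 / real (Suc m)" for m
  have "\<exists>a\<in>?H m. I a < d m + q m" for m
    using cInf_lessD[OF ne[of m], of "d m + q m"] by (auto simp: d_def q_def)
  then obtain h where h: "\<And>m. h m \<in> ?H m" "\<And>m. I (h m) < d m + q m"
    by metis
  \<comment> \<open>By the parallelogram law, near-minimisers of the norm on the nested convex sets form a
    Cauchy sequence.\<close>
  have par: "(LINT x|N. (h m x - h n x)\<^sup>2) \<le> 2 * d n - 2 * d m + 4 * q m" if "m \<le> n" for m n
  proof -
    have hn: "h n \<in> ?H m" using h(1) tail_midpoints_antimono[OF that] by blast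
    define c where "c x = (h m x + h n x) / 2" for x
    have c: "c \<in> ?H m"
      using tail_midpoints.midpoint[OF h(1) hn] by (simp add: c_def[abs_def])
    have "(LINT x|N. (h m x - h n x)\<^sup>2) =
        (LINT x|N. 2 * (h m x * h m x) + 2 * (h n x * h n x) - 4 * (c x * c x))"
      by (intro Bochner_Integration.integral_cong) (auto simp: c_def power2_eq_square field_simps)
    also have "\<dots> = 2 * I (h m) + 2 * I (h n) - 4 * I c"
      using int[OF h(1) h(1)] int[OF c c] by (simp add: I_def power2_eq_square)
    \<comment> \<open>The midpoint \<open>c\<close> lies in the larger set \<open>?H m\<close>, so
      \<open>I c\<close> is at least \<open>d m\<close>. The right-hand side is then below
      2(\<open>d m\<close> + \<open>q m\<close>) + 2(\<open>d n\<close> + \<open>q n\<close>) - 4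
      \<open>d m\<close>.\<close>
    finally have "(LINT x|N. (h m x - h n x)\<^sup>2) = 2 * I (h m) + 2 * I (h n) - 4 * I c" .
    moreover have "q n \<le> q m" using that by (simp add: q_def frac_le)
    ultimately show ?thesis using h(2)[of m] h(2)[of n] d_le[OF c] by linarith
  qed
  obtain r where r: "strict_mono r" "AE x in N. convergent (\<lambda>i. h (r i) x)"
  proof (rule N.Cauchy_L2_AE_convergent_subseq)
    show "h n \<in> borel_measurable N" for n by (rule measH[OF h(1)])
    show "\<bar>h n x\<bar> \<le> L" for n x by (rule bddH[OF h(1)])
    fix e :: real assume "e > 0"
    then obtain K1 where K1: "\<And>m n. m \<ge> K1 \<Longrightarrow> n \<ge> K1 \<Longrightarrow> dist (d m) (d n) < e / 4"
      using \<open>Cauchy d\<close> unfolding Cauchy_def by (metis zero_less_divide_iff zero_less_numeral)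
    \<comment> \<open>This makes 4 \<open>q m\<close> less than \<open>e / 2\<close>; the other half
      comes from twice the increase of \<open>d\<close>, controlled by \<open>K1\<close>.\<close>
    obtain K2 where K2: "8 / e < real K2" using reals_Archimedean2 by blast
    have "(LINT x|N. (h m x - h n x)\<^sup>2) < e" if "m \<ge> max K1 K2" "n \<ge> m" for m n
    proof -
      have "8 / e < real (Suc m)" using K2 that by simp
      then have "4 * q m < e / 2" using \<open>e > 0\<close> by (simp add: q_def field_simps)
      moreover have "K1 \<le> m" "K1 \<le> n" using that by auto
      from K1[OF this] have "d n - d m < e / 4"
        unfolding dist_real_def by linarith
      ultimately show ?thesis using par[OF that(2)] by linarith
    qed
    then show "\<exists>K. \<forall>m\<ge>K. \<forall>n\<ge>m. (LINT x|N. (h m x - h n x)\<^sup>2) < e" by blast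
  qed
  \<comment> \<open>Truncation enforces the bound at every point, including those where the sequence
    diverges and \<open>lim\<close> is arbitrary. Where it converges, truncation changes
    nothing.\<close>
  define g where "g x = max (- L) (min L (lim (\<lambda>i. h (r i) x)))" for x
  have measM: "h n \<in> borel_measurable M" for n
    by (rule tail_midpoints_measurable[OF meas h(1)])
  have L: "L \<ge> 0" using bdd[of 0 undefined] by linarith
  have g: "g \<in> borel_measurable M"
    unfolding g_def using measM by (intro borel_measurable_max borel_measurable_min borel_measurable_lim_metric) auto
  have "(LINT x|M. g x * \<phi> x) = l"
    if \<phi>: "integrable M \<phi>" and l: "(\<lambda>k. LINT x|M. u k x * \<phi> x) \<longlonglongrightarrow> l" for \<phi> l
  proof -
    have dom: "integrable M (\<lambda>x. L * \<bar>\<phi> x\<bar>)" using \<phi> by simp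
    have "integrable M (\<lambda>x. u k x * \<phi> x)" for k
      by (rule Bochner_Integration.integrable_bound[OF dom])
        (use meas \<phi> bdd L in \<open>auto simp: abs_mult intro!: mult_right_mono\<close>)
    note ih = tail_midpoints_integral[OF this]
    have "(\<lambda>i. LINT x|M. h (r i) x * \<phi> x) \<longlonglongrightarrow> l"
    proof (rule LIMSEQ_I)
      fix e :: real assume "e > 0"
      then obtain K where K: "\<And>k. k \<ge> K \<Longrightarrow> \<bar>(LINT x|M. u k x * \<phi> x) - l\<bar> < e / 2"
        using LIMSEQ_D[OF l, of "e / 2"] by auto
      have "norm ((LINT x|M. h (r i) x * \<phi> x) - l) < e" if "i \<ge> K" for i
      proof -
        \<comment> \<open>\<open>r i\<close> is at least \<open>i\<close>, so \<open>h (r i)\<close>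
          averages only terms of index at least \<open>K\<close>.\<close>
        have "h (r i) \<in> ?H K"
          using h(1)[of "r i"] tail_midpoints_antimono[of K "r i"] seq_suble[OF r(1), of i] that
          by (meson order_trans subsetD)
        then have "\<bar>(LINT x|M. h (r i) x * \<phi> x) - l\<bar> \<le> e / 2"
          using ih[where m = K and l = l and e = "e / 2"] K by (meson less_imp_le)
        with \<open>e > 0\<close> show ?thesis by simp
      qed
      then show "\<exists>K. \<forall>i\<ge>K. norm ((LINT x|M. h (r i) x * \<phi> x) - l) < e" by blast
    qed
    moreover have "(\<lambda>i. LINT x|M. h (r i) x * \<phi> x) \<longlonglongrightarrow> (LINT x|M. g x * \<phi> x)"
    proof (rule integral_dominated_convergence[OF _ _ dom])
      have "AE x in M. convergent (\<lambda>i. h (r i) x)" using r(2) AE by blast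
      then show "AE x in M. (\<lambda>i. h (r i) x * \<phi> x) \<longlonglongrightarrow> g x * \<phi> x"
      proof eventually_elim
        case (elim x)
        then have lim: "(\<lambda>i. h (r i) x) \<longlonglongrightarrow> lim (\<lambda>i. h (r i) x)"
          by (simp add: convergent_LIMSEQ_iff)
        have b: "- L \<le> h (r i) x" "h (r i) x \<le> L" for i
          using bddH[OF h(1), of "r i" x] by auto
        have "lim (\<lambda>i. h (r i) x) \<le> L" "- L \<le> lim (\<lambda>i. h (r i) x)"
          using b by (auto intro: LIMSEQ_le_const2[OF lim] LIMSEQ_le_const[OF lim])
        then have "g x = lim (\<lambda>i. h (r i) x)" by (simp add: g_def)
        with lim show ?case by (auto intro: tendsto_mult)
      qed
      show "AE x in M. norm (h (r i) x * \<phi> x) \<le> L * \<bar>\<phi> x\<bar>" for i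
        using bddH[OF h(1), of "r i"] by (auto simp: abs_mult intro!: mult_right_mono)
    qed (use g measM \<phi> in auto)
    ultimately show ?thesis by (rule LIMSEQ_unique[symmetric])
  qed
  moreover have "\<bar>g x\<bar> \<le> L" for x using L by (auto simp: g_def)
  ultimately show ?thesis using that g by blast
qed

section \<open>From Lipschitz bounds along the axes to weak derivatives\<close>

lemma locally_integrable_bounded:
  assumes "h \<in> borel_measurable lebesgue" "\<And>x. \<bar>h x\<bar> \<le> B"
  shows "locally_integrable U h"
  unfolding locally_integrable_def set_integrable_def
proof (intro allI impI)
  fix C :: "(real ^ 'a) set" assume "compact C \<and> C \<subseteq> U"
  then have "C \<in> lmeasurable" by (simp add: lmeasurable_compact)
  then have "integrable lebesgue (\<lambda>x. indicat_real C x * B)"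
    by (intro integrable_mult_left) (simp add: lmeasurable_iff_integrable)
  then show "integrable lebesgue (\<lambda>x. indicat_real C x *\<^sub>R h x)"
  proof (rule Bochner_Integration.integrable_bound)
    show "(\<lambda>x. indicat_real C x *\<^sub>R h x) \<in> borel_measurable lebesgue"
      using \<open>C \<in> lmeasurable\<close> assms(1) by (intro borel_measurable_scaleR borel_measurable_indicator) auto
    show "AE x in lebesgue. norm (indicat_real C x *\<^sub>R h x) \<le> norm (indicat_real C x * B)"
      using assms(2) by (intro AE_I2) (auto simp: abs_mult indicator_def intro: order_trans[OF _ abs_ge_self])
  qed
qed

text \<open>The difference quotients \<open>u k\<close> in direction \<open>i\<close> are bounded by
  \<open>M\<close>, hence \<open>bounded_weak_limit\<close> supplies a candidate \<open>g\<close>.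
  Against a test function their integrals converge to minus the integral of \<open>f\<close> times
  the partial derivative, so \<open>g\<close> is the weak derivative.\<close>

lemma axis_Lipschitz_imp_W1_infinity:
  fixes f :: "real ^ 'n \<Rightarrow> real"
  assumes f: "continuous_on UNIV f" and B: "\<And>x. \<bar>f x\<bar> \<le> B"
    and lip: "\<And>i x t. \<bar>f (x + t *\<^sub>R axis i 1) - f x\<bar> \<le> M * \<bar>t\<bar>"
  shows "f \<in> W1_infinity UNIV"
proof -
  have Linf: "h \<in> L_infinity UNIV"
    if "h \<in> borel_measurable borel" "\<And>x. \<bar>h x\<bar> \<le> C" for h :: "real ^ 'n \<Rightarrow> real" and C
  proof -
    have "h \<in> borel_measurable lebesgue"
      using that(1) by (simp add: measurable_completion)
    then have "h \<in> borel_measurable (lebesgue_on UNIV)"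
      by (rule measurable_restrict_space1)
    then show ?thesis
      using that(2) by (auto simp: L_infinity_def)
  qed
  have fm: "f \<in> borel_measurable borel"
    using f by (rule borel_measurable_continuous_onI)
  have "\<exists>g\<in>L_infinity UNIV. weak_partial_derivative UNIV i f g" for i
  proof -
    let ?e = "axis i 1 :: real ^ 'n"
    define q where "q k = 1 / real (Suc k)" for k
    define u where "u k x = (f (x + q k *\<^sub>R ?e) - f x) / q k" for k x
    have q: "q k > 0" for k by (simp add: q_def)
    have uc: "continuous_on UNIV (u k)" for k
      unfolding u_def using q[of k] by (intro continuous_intros continuous_on_compose2[OF f]) auto
    have "\<bar>u k x\<bar> \<le> M" for k x
      using lip[of x "q k" i] q[of k] by (simp add: u_def pos_divide_le_eq)
    moreover have "u k \<in> borel_measurable lborel" for k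
      using uc by (simp add: borel_measurable_continuous_onI)
    ultimately obtain g where g: "g \<in> borel_measurable lborel" "\<And>x. \<bar>g x\<bar> \<le> M"
      and lim: "\<And>\<phi> l. integrable lborel \<phi> \<Longrightarrow> (\<lambda>k. LINT x|lborel. u k x * \<phi> x) \<longlonglongrightarrow> l \<Longrightarrow>
        (LINT x|lborel. g x * \<phi> x) = l"
      using lborel.bounded_weak_limit[of u M] by blast
    have "(LINT x:UNIV|lebesgue. f x * partial_derivative i \<phi> x) = - (LINT x:UNIV|lebesgue. g x * \<phi> x)"
      if \<phi>: "test_function UNIV \<phi>" for \<phi>
    proof -
      have \<phi>c: "continuous_on UNIV \<phi>"
        by (rule test_function_continuous[OF \<phi>])
      have supp: "compact (closure {x. \<phi> x \<noteq> 0})"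
        using \<phi> unfolding test_function_def by blast
      have int: "integrable lborel (\<lambda>x. h x * \<phi> x)" if "continuous_on UNIV h" for h
      proof (rule integrable_continuous_compact_support[OF _ supp])
        show "continuous_on UNIV (\<lambda>x. h x * \<phi> x)"
          by (intro continuous_on_mult that \<phi>c)
        show "h x * \<phi> x = 0" if "x \<notin> closure {x. \<phi> x \<noteq> 0}" for x
          using eq_0_outside_support[OF that] by simp
      qed
      define F where "F h = (LINT y|lborel. f y * \<phi> (y - h *\<^sub>R ?e))" for h
      let ?D = "LINT y|lborel. f y * partial_derivative i \<phi> y"
      have "(F has_real_derivative - ?D) (at 0)"
        using has_real_derivative_integral_translate[OF f \<phi>, of i 0] by (simp add: F_def[abs_def])
      then have "((\<lambda>h. (F h - F 0) / h) \<longlongrightarrow> - ?D) (at 0)"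
        by (simp add: DERIV_def)
      moreover have "filterlim q (at 0) sequentially"
      proof (rule filterlim_atI)
        show "q \<longlonglongrightarrow> 0"
          using LIMSEQ_inverse_real_of_nat by (simp only: q_def[abs_def] inverse_eq_divide)
        show "\<forall>\<^sub>F k in sequentially. q k \<noteq> 0"
          using q by (intro always_eventually allI less_imp_neq[symmetric])
      qed
      ultimately have "(\<lambda>k. (F (q k) - F 0) / q k) \<longlonglongrightarrow> - ?D"
        by (rule filterlim_compose)
      \<comment> \<open>Discrete integration by parts: translation invariance moves the shift from
        \<open>\<phi>\<close> to \<open>f\<close>.\<close>
      also have "(\<lambda>k. (F (q k) - F 0) / q k) = (\<lambda>k. LINT x|lborel. u k x * \<phi> x)"
      proof
        fix k
        have c: "continuous_on UNIV (\<lambda>y. f (y + q k *\<^sub>R ?e))"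
          by (intro continuous_intros continuous_on_compose2[OF f]) auto
        then have "(\<lambda>y. f (y + q k *\<^sub>R ?e) * \<phi> y) \<in> borel_measurable borel"
          by (intro borel_measurable_continuous_onI continuous_on_mult \<phi>c)
        from lborel_integral_translation[OF this, of "- q k *\<^sub>R ?e"]
        have "F (q k) = (LINT y|lborel. f (y + q k *\<^sub>R ?e) * \<phi> y)"
          by (simp add: F_def)
        then have "F (q k) - F 0 = (LINT y|lborel. (f (y + q k *\<^sub>R ?e) - f y) * \<phi> y)"
          using int[OF c] int[OF f] by (simp add: F_def left_diff_distrib)
        then show "(F (q k) - F 0) / q k = (LINT x|lborel. u k x * \<phi> x)"
          by (simp add: u_def)
      qed
      finally have "(LINT x|lborel. g x * \<phi> x) = - ?D"
        using int[of "\<lambda>_. 1"] by (intro lim) auto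
      moreover have "(LINT x|lebesgue. g x * \<phi> x) = (LINT x|lborel. g x * \<phi> x)"
        using g(1) borel_measurable_continuous_onI[OF \<phi>c]
        by (intro integral_completion borel_measurable_times) simp_all
      moreover have "(LINT x|lebesgue. f x * partial_derivative i \<phi> x) = ?D"
        using fm borel_measurable_continuous_onI[OF test_function_continuous_partial[OF \<phi>, of i]]
        by (intro integral_completion borel_measurable_times) simp_all
      ultimately show ?thesis
        by (simp add: set_lebesgue_integral_def)
    qed
    moreover have "locally_integrable UNIV f"
      by (rule locally_integrable_bounded[OF _ B]) (simp add: measurable_completion fm)
    moreover have "locally_integrable UNIV g"
      by (rule locally_integrable_bounded[OF _ g(2)]) (rule measurable_completion[OF g(1)])
    ultimately have "weak_partial_derivative UNIV i f g"
      unfolding weak_partial_derivative_def by blast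
    moreover have "g \<in> L_infinity UNIV"
      using g by (intro Linf) auto
    ultimately show ?thesis by blast
  qed
  with Linf[OF fm B] show ?thesis
    by (simp add: W1_infinity_def)
qed

section \<open>A fat removable set\<close>

lemma abs_le_of_dense:
  fixes f :: "real ^ 'n \<Rightarrow> real"
  assumes "continuous_on UNIV f" and "\<And>x. x \<in> S \<Longrightarrow> \<bar>f x\<bar> \<le> B" and "closure S = UNIV"
  shows "\<bar>f x\<bar> \<le> B"
proof -
  have "closed {x. \<bar>f x\<bar> \<le> B}"
    using assms(1) by (intro closed_Collect_le continuous_intros)
  then have "closure S \<subseteq> {x. \<bar>f x\<bar> \<le> B}"
    using assms(2) by (intro closure_minimal) auto
  then show ?thesis using assms(3) by auto
qed

theorem proposition1p4:
  assumes "CARD('n::finite) \<ge> 2"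
  shows "\<exists>K :: (real ^ 'n) set. compact K \<and> emeasure lebesgue K > 0 \<and> W1_infinity_removable K"
proof -
  define S where "S = (\<Union>i. \<Union>q\<in>\<rat>. {x :: real ^ 'n. x $ i = q})"
  have "negligible {x :: real ^ 'n. x $ i = q}" for i q
    using negligible_hyperplane[of "axis i 1 :: real ^ 'n" q] by (simp add: inner_axis' axis_eq_0_iff)
  then have "negligible S"
    unfolding S_def by (intro negligible_countable_Union countable_UN countable_image) (auto simp: countable_rat)
  then have S: "S \<in> null_sets lebesgue" by (simp add: negligible_iff_null_sets)
  \<comment> \<open>Outer regularity with tolerance 1. As \<open>S\<close> is null, \<open>T\<close>
    itself has measure less than 1.\<close>
  then obtain T where T: "open T" "S \<subseteq> T" "T - S \<in> lmeasurable" "emeasure lebesgue (T - S) < ennreal 1"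
    using sets_lebesgue_outer_open[of S 1] by auto
  have TS: "emeasure lebesgue T < 1"
    using emeasure_Diff_null_set[OF S, of T] T(1,4) by simp
  \<comment> \<open>\<open>One\<close> is the vector with all coordinates 1, so the box is the unit
    cube, of measure 1, and \<open>T\<close> cannot fill it.\<close>
  define K where "K = cbox 0 (One :: real ^ 'n) - T"
  have K: "compact K" unfolding K_def using T(1) by (intro compact_diff compact_cbox)
  have [measurable]: "K \<in> sets lebesgue" "T \<in> sets lebesgue"
    using compact_imp_closed[OF K] T(1) by auto
  have "1 = emeasure lebesgue (cbox 0 (One :: real ^ 'n))"
    by (simp add: emeasure_lborel_cbox_eq)
  also have "\<dots> \<le> emeasure lebesgue (K \<union> T)"
    by (intro emeasure_mono) (auto simp: K_def)
  also have "\<dots> \<le> emeasure lebesgue K + emeasure lebesgue T"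
    by (intro emeasure_subadditive) auto
  finally have Kpos: "emeasure lebesgue K > 0"
    using TS by (cases "emeasure lebesgue K = 0") (auto simp: zero_less_iff_neq_zero)
  have line: "x + s *\<^sub>R axis i 1 \<notin> K" if "\<And>j. x $ j \<in> \<rat>" for x :: "real ^ 'n" and s i
  proof -
    \<comment> \<open>Dimension at least 2 provides a second coordinate, which stays constant and
      rational along the line.\<close>
    obtain j where "j \<noteq> i"
      using assms card_1_singletonE
      by (metis (full_types) One_nat_def UNIV_I card_le_Suc0_iff_eq finite not_less_eq_eq numeral_2_eq_2)
    then have "(x + s *\<^sub>R axis i 1) $ j = x $ j" by (simp add: axis_def)
    then have "x + s *\<^sub>R axis i 1 \<in> S" using that unfolding S_def by blast
    then show ?thesis using T(2) by (auto simp: K_def)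
  qed
  define Q where "Q = {x :: real ^ 'n. \<forall>j. x $ j \<in> \<rat>}"
  have Q: "closure Q = UNIV"
  proof -
    have "\<exists>y\<in>Q. dist y x < e" if "e > 0" for x :: "real ^ 'n" and e
    proof -
      \<comment> \<open>The Euclidean norm is at most the sum of the absolute coordinates, so errors
        below \<open>e / CARD('n)\<close> in each suffice.\<close>
      define d where "d = e / CARD('n)"
      have "d > 0" using that by (simp add: d_def)
      then have "\<exists>r\<in>\<rat>. x $ j < r \<and> r < x $ j + d" for j
        by (intro Rats_dense_in_real) simp
      then obtain r where r: "\<And>j. r j \<in> \<rat>" "\<And>j. x $ j < r j" "\<And>j. r j < x $ j + d"
        by metis
      have "dist (\<chi> j. r j) x \<le> (\<Sum>j\<in>UNIV. \<bar>((\<chi> j. r j) - x) $ j\<bar>)"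
        unfolding dist_norm by (rule norm_le_l1_cart)
      also have "\<dots> < (\<Sum>j\<in>(UNIV :: 'n set). d)"
      proof (rule sum_strict_mono)
        show "\<bar>((\<chi> j. r j) - x) $ j\<bar> < d" for j
          using r(2,3)[of j] by (simp add: abs_less_iff)
      qed auto
      also have "\<dots> = e" by (simp add: d_def)
      finally show ?thesis
        using r(1) by (intro bexI[of _ "\<chi> j. r j"]) (auto simp: Q_def)
    qed
    then show ?thesis by (auto simp: closure_approachable)
  qed
  have "f \<in> W1_infinity UNIV" if f: "continuous_on UNIV f" and W: "f \<in> W1_infinity (UNIV - K)" for f
  proof -
    let ?U = "UNIV - K"
    have U: "open ?U" using compact_imp_closed[OF K] by (simp add: open_Diff)
    have "\<exists>M. \<forall>x\<in>Q. \<forall>t. \<bar>f (x + t *\<^sub>R axis i 1) - f x\<bar> \<le> M * \<bar>t\<bar>" for i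
    proof -
      obtain g M where g: "weak_partial_derivative ?U i f g" and M: "AE x in lebesgue_on ?U. \<bar>g x\<bar> \<le> M"
        using W unfolding W1_infinity_def L_infinity_def by blast
      have pos: "\<bar>f (x + t *\<^sub>R axis i 1) - f x\<bar> \<le> M * t" if "t > 0" "\<And>s. x + s *\<^sub>R axis i 1 \<notin> K" for x t
        using that by (intro weak_partial_derivative_segment_bound[OF U f g M]) auto
      have "\<bar>f (x + t *\<^sub>R axis i 1) - f x\<bar> \<le> M * \<bar>t\<bar>" if "x \<in> Q" for x t
      proof (cases t "0 :: real" rule: linorder_cases)
        case less
        \<comment> \<open>For negative \<open>t\<close> the segment is run from its other endpoint.
          That endpoint need not lie in \<open>Q\<close>, but it is on the same line, which misses
          \<open>K\<close>.\<close>
        have "x + t *\<^sub>R axis i 1 + s *\<^sub>R axis i 1 \<notin> K" for s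
          using line[of x "t + s" i] that by (simp add: Q_def scaleR_add_left add.assoc)
        from pos[OF _ this, of "- t"] less show ?thesis by (simp add: abs_minus_commute)
      next
        case greater
        with pos[OF greater] line[of x _ i] that show ?thesis by (simp add: Q_def)
      qed simp
      then show ?thesis by blast
    qed
    then obtain M where M: "\<And>i x t. x \<in> Q \<Longrightarrow> \<bar>f (x + t *\<^sub>R axis i 1) - f x\<bar> \<le> M i * \<bar>t\<bar>"
      by metis
    \<comment> \<open>The maximum over the finitely many directions gives one constant. For fixed
      \<open>t\<close> the inequality is closed in \<open>x\<close>, so it extends from the dense
      set \<open>Q\<close> to all points, those of \<open>K\<close> included.\<close>
    have "\<bar>f (x + t *\<^sub>R axis i 1) - f x\<bar> \<le> Max (range M) * \<bar>t\<bar>" for i x t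
    proof (rule abs_le_of_dense[OF _ _ Q])
      show "continuous_on UNIV (\<lambda>x. f (x + t *\<^sub>R axis i 1) - f x)"
        by (intro continuous_intros continuous_on_compose2[OF f]) auto
      have "M i \<le> Max (range M)" by simp
      then show "\<bar>f (x + t *\<^sub>R axis i 1) - f x\<bar> \<le> Max (range M) * \<bar>t\<bar>" if "x \<in> Q" for x
        by (intro order_trans[OF M[OF that]] mult_right_mono) auto
    qed
    moreover
    obtain B where B: "AE x in lebesgue_on ?U. \<bar>f x\<bar> \<le> B"
      using W unfolding W1_infinity_def L_infinity_def by blast
    \<comment> \<open>The essential bound off \<open>K\<close> holds at every point of the open
      complement by continuity; that complement contains \<open>Q\<close>, and density carries the
      bound over to \<open>K\<close>.\<close>
    have "\<bar>f x\<bar> \<le> B" for x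
    proof (rule abs_le_of_dense[OF f _ Q])
      have "continuous_on ?U (\<lambda>x. \<bar>f x\<bar>)"
        by (intro continuous_intros continuous_on_subset[OF f]) auto
      then show "\<bar>f x\<bar> \<le> B" if "x \<in> Q" for x
        using line[of x 0] that by (intro AE_le_imp_le_on_open[OF _ U B]) (auto simp: Q_def)
    qed
    ultimately show ?thesis by (intro axis_Lipschitz_imp_W1_infinity[OF f])
  qed
  then have "W1_infinity_removable K"
    unfolding W1_infinity_removable_def using K by blast
  with K Kpos show ?thesis by blast
qed

end
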